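(* Let $X$ be a real normed linear space, $\Omega\subseteq X$ a nonempty closed set, $v\in X$ nonzero, and $T(x):=\inf\{t\ge 0\mid x+tv\in\Omega\}$. For any $\bar x\in\operatorname{dom}T\setminus\Omega$, $$\partial^\infty T(\bar x)\subseteq\{v\}^\perp\cap N(\bar x+T(\bar x)v;\Omega),$$ where $\partial^\infty$ is the singular subdifferential and $N$ is the limiting (Mordukhovich) normal cone.
   Context: $T$ takes values in $[0,\infty]$ with $\inf\emptyset=\infty$, and $\operatorname{dom}T:=\{x\mid T(x)<\infty\}$; for $x\in\operatorname{dom}T$ the point $x+T(x)v$ lies in $\Omega$. $X^*$ is the topological dual of $X$; $\{v\}^\perp:=\{x^*\in X^*\mid\langle x^*,v\rangle=0\}$. The Fréchet normal cone $\widehat N(y;\Omega)$ at $y\in\Omega$ is the set of $x^*\in X^*$ such that for every $\varepsilon>0$ there is $\delta>0$ with $\langle x^*,x-y\rangle\le\varepsilon\|x-y\|$ for all $x\in\Omega$ with $\|x-y\|\le\delta$. The limiting normal cone $N(y;\Omega)$ is the set of $x^*\in X^*$ for which there are sequences $x_k\to y$ with $x_k\in\Omega$, and $x_k^*\in\widehat N(x_k;\Omega)$ with $x_k^*\to x^*$ weak$^*$. For $\psi:X\to(-\infty,\infty]$ and $\psi(\bar x)<\infty$, the Fréchet subdifferential $\widehat\partial\psi(\bar x)$ is the set of $x^*\in X^*$ such that for every $\varepsilon>0$ there is $\delta>0$ with $\langle x^*,x-\bar x\rangle\le\psi(x)-\psi(\bar x)+\varepsilon\|x-\bar x\|$ whenever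 $\|x-\bar x\|\le\delta$. The singular subdifferential $\partial^\infty\psi(\bar x)$ is the set of $x^*\in X^*$ for which there are sequences $\lambda_k\to0$ with $\lambda_k>0$, $x_k\to\bar x$ with $\psi(x_k)\to\psi(\bar x)$, and $x_k^*\in\widehat\partial\psi(x_k)$ with $\lambda_kx_k^*\to x^*$ weak$^*$. *)

theory Defs
  imports "HOL-Analysis.Analysis"
begin

type_synonym 'a dual = "'a \<Rightarrow>\<^sub>L real"

(* For real-valued operators the strong operator topology, i.e. the topology of pointwise
   convergence, is the weak* topology of the dual. *)
abbreviation weak_star_topology :: "'a::real_normed_vector dual topology" where
  "weak_star_topology \<equiv> strong_operator_topology"

lemma limitin_weak_star_iff:
  fixes xs :: "'b \<Rightarrow> 'a::real_normed_vector dual"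
  shows "limitin weak_star_topology xs l F
    \<longleftrightarrow> (\<forall>u. ((\<lambda>k. blinfun_apply (xs k) u) \<longlongrightarrow> blinfun_apply l u) F)"
proof
  assume L: "limitin weak_star_topology xs l F"
  show "\<forall>u. ((\<lambda>k. blinfun_apply (xs k) u) \<longlongrightarrow> blinfun_apply l u) F"
  proof
    fix u
    have "limitin euclidean ((\<lambda>f. blinfun_apply f u) \<circ> xs) (blinfun_apply l u) F"
      by (rule continuous_map_limit[OF strong_operator_topology_continuous_evaluation L])
    then show "((\<lambda>k. blinfun_apply (xs k) u) \<longlongrightarrow> blinfun_apply l u) F"
      by (simp add: o_def)
  qed
next
  assume P: "\<forall>u. ((\<lambda>k. blinfun_apply (xs k) u) \<longlongrightarrow> blinfun_apply l u) F"
  then have lim: "limitin (euclidean :: ('a \<Rightarrow> real) topology) (blinfun_apply \<circ> xs)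
      (blinfun_apply l) F"
    unfolding euclidean_product_topology[symmetric] limitin_componentwise by (simp add: o_def)
  show "limitin weak_star_topology xs l F"
    unfolding limitin_def
  proof (intro conjI allI impI)
    show "l \<in> topspace weak_star_topology"
      by (simp add: strong_operator_topology_topspace)
    fix U assume "openin weak_star_topology U \<and> l \<in> U"
    then obtain V where V: "open V" "U = blinfun_apply -` V" "l \<in> U"
      by (auto simp: strong_operator_topology_def openin_pullback_topology)
    then have "\<forall>\<^sub>F k in F. (blinfun_apply \<circ> xs) k \<in> V"
      using lim by (auto simp: limitin_def)
    then show "\<forall>\<^sub>F k in F. xs k \<in> U"
      using V by simp
  qed
qed

definition annihilator :: "'a::real_normed_vector set \<Rightarrow> 'a dual set" where
  "annihilator S = {f. \<forall>u\<in>S. blinfun_apply f u = 0}"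

definition frechet_normal_cone :: "'a::real_normed_vector \<Rightarrow> 'a set \<Rightarrow> 'a dual set" where
  "frechet_normal_cone y \<Omega> = {f. y \<in> \<Omega> \<and>
     (\<forall>\<epsilon>>0. \<exists>\<delta>>0. \<forall>x\<in>\<Omega>. norm (x - y) \<le> \<delta> \<longrightarrow>
        blinfun_apply f (x - y) \<le> \<epsilon> * norm (x - y))}"

definition limiting_normal_cone :: "'a::real_normed_vector \<Rightarrow> 'a set \<Rightarrow> 'a dual set" where
  "limiting_normal_cone y \<Omega> = {f. \<exists>xs fs. xs \<longlonglongrightarrow> y \<and> (\<forall>k. xs k \<in> \<Omega>) \<and>
     (\<forall>k. fs k \<in> frechet_normal_cone (xs k) \<Omega>) \<and>
     limitin weak_star_topology fs f sequentially}"

definition effective_domain :: "('a \<Rightarrow> ereal) \<Rightarrow> 'a set" where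
  "effective_domain \<psi> = {x. \<psi> x < \<infinity>}"

(* Functions into (-\<infinity>, \<infinity>] are modelled as ereal-valued functions; the subdifferentials are
   empty wherever \<psi> is not finite. As \<psi> x is finite, no \<infinity> - \<infinity> arises. *)
definition frechet_subdifferential ::
    "('a::real_normed_vector \<Rightarrow> ereal) \<Rightarrow> 'a \<Rightarrow> 'a dual set" where
  "frechet_subdifferential \<psi> x = {f. \<bar>\<psi> x\<bar> \<noteq> \<infinity> \<and>
     (\<forall>\<epsilon>>0. \<exists>\<delta>>0. \<forall>y. norm (y - x) \<le> \<delta> \<longrightarrow>
        ereal (blinfun_apply f (y - x)) \<le> \<psi> y - \<psi> x + ereal (\<epsilon> * norm (y - x)))}"

definition singular_subdifferential ::
    "('a::real_normed_vector \<Rightarrow> ereal) \<Rightarrow> 'a \<Rightarrow> 'a dual set" where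
  "singular_subdifferential \<psi> x = {f. \<bar>\<psi> x\<bar> \<noteq> \<infinity> \<and>
     (\<exists>ls xs fs. ls \<longlonglongrightarrow> (0::real) \<and> (\<forall>k. ls k > 0) \<and>
        xs \<longlonglongrightarrow> x \<and> (\<lambda>k. \<psi> (xs k)) \<longlonglongrightarrow> \<psi> x \<and>
        (\<forall>k. fs k \<in> frechet_subdifferential \<psi> (xs k)) \<and>
        limitin weak_star_topology (\<lambda>k. ls k *\<^sub>R fs k) f sequentially)}"

definition directional_minimal_time ::
    "'a::real_normed_vector set \<Rightarrow> 'a \<Rightarrow> 'a \<Rightarrow> ereal" where
  "directional_minimal_time \<Omega> v x = (INF t \<in> {t. 0 \<le> t \<and> x + t *\<^sub>R v \<in> \<Omega>}. ereal t)"

end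

(* Fix x with t = T x finite. Since T (z - t v) \<le> t for z in \<Omega>, every Frechet subgradient of T
   at x is a Frechet normal to \<Omega> at x + t v. If moreover t > 0, then T (x + s v) \<le> t - s for small s
   of either sign, so every Frechet subgradient takes the value -1 at v. After scaling by
   \<lambda>\<^sub>k \<rightarrow> 0 the normals stay normals by the cone property, while their values -\<lambda>\<^sub>k at v vanish in
   the limit. *)

theory Submission
  imports Defs
begin

text \<open>Passes from \<open>ereal\<close> to real arithmetic. Since \<open>\<psi> y\<close>
  enters only through an upper bound \<open>r\<close>, upper estimates of the minimal time are
  enough to exploit a subgradient.\<close>

lemma frechet_subdifferentialD:
  assumes "f \<in> frechet_subdifferential \<psi> x" and "\<epsilon> > 0"
  obtains \<delta> where "\<delta> > 0"
    and "\<And>y r. norm (y - x) \<le> \<delta> \<Longrightarrow> \<psi> y \<le> ereal r \<Longrightarrow>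
      blinfun_apply f (y - x) \<le> r - real_of_ereal (\<psi> x) + \<epsilon> * norm (y - x)"
proof -
  from assms obtain a where a: "\<psi> x = ereal a"
    by (auto simp: frechet_subdifferential_def)
  from assms obtain \<delta> where "\<delta> > 0" and \<delta>: "\<And>y. norm (y - x) \<le> \<delta> \<Longrightarrow>
      ereal (blinfun_apply f (y - x)) \<le> \<psi> y - \<psi> x + ereal (\<epsilon> * norm (y - x))"
    by (auto simp: frechet_subdifferential_def)
  have "blinfun_apply f (y - x) \<le> r - real_of_ereal (\<psi> x) + \<epsilon> * norm (y - x)"
    if "norm (y - x) \<le> \<delta>" "\<psi> y \<le> ereal r" for y r
    using \<delta>[OF that(1)] that(2) by (cases "\<psi> y") (auto simp: a)
  with \<open>\<delta> > 0\<close> show thesis by (rule that)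
qed

lemma frechet_normal_cone_scaleR:
  assumes "f \<in> frechet_normal_cone y \<Omega>" and "0 < c"
  shows "c *\<^sub>R f \<in> frechet_normal_cone y \<Omega>"
  unfolding frechet_normal_cone_def
proof (intro CollectI conjI allI impI)
  show "y \<in> \<Omega>" using assms by (simp add: frechet_normal_cone_def)
  fix \<epsilon> :: real assume "\<epsilon> > 0"
  then have "\<epsilon> / c > 0" using \<open>0 < c\<close> by simp
  then obtain \<delta> where "\<delta> > 0" and \<delta>: "\<And>x. x \<in> \<Omega> \<Longrightarrow> norm (x - y) \<le> \<delta> \<Longrightarrow>
      blinfun_apply f (x - y) \<le> \<epsilon> / c * norm (x - y)"
    using assms(1) unfolding frechet_normal_cone_def by blast
  show "\<exists>\<delta>>0. \<forall>x\<in>\<Omega>. norm (x - y) \<le> \<delta> \<longrightarrow>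
      blinfun_apply (c *\<^sub>R f) (x - y) \<le> \<epsilon> * norm (x - y)"
    using \<open>\<delta> > 0\<close> \<delta> \<open>0 < c\<close> by (intro exI[of _ \<delta>]) (auto simp: blinfun.scaleR_left field_simps)
qed

lemma directional_minimal_time_le:
  assumes "0 \<le> t" and "x + t *\<^sub>R v \<in> \<Omega>"
  shows "directional_minimal_time \<Omega> v x \<le> ereal t"
  unfolding directional_minimal_time_def using assms by (intro INF_lower) simp

lemma directional_minimal_time_nonneg: "0 \<le> directional_minimal_time \<Omega> v x"
  unfolding directional_minimal_time_def by (intro INF_greatest) simp

text \<open>The feasible times form a closed set bounded below by 0, and a finite value makes this
  set nonempty, so it contains its infimum.\<close>

lemma directional_minimal_time_attained:
  assumes "closed \<Omega>" and "directional_minimal_time \<Omega> v x = ereal a"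
  shows "x + a *\<^sub>R v \<in> \<Omega>"
proof -
  let ?S = "{t. 0 \<le> t \<and> x + t *\<^sub>R v \<in> \<Omega>}"
  have "closed ((\<lambda>t. x + t *\<^sub>R v) -` \<Omega>)"
    using \<open>closed \<Omega>\<close> by (intro continuous_closed_vimage continuous_intros)
  then have "closed ({0..} \<inter> (\<lambda>t. x + t *\<^sub>R v) -` \<Omega>)"
    by (intro closed_Int) auto
  moreover have "{0..} \<inter> (\<lambda>t. x + t *\<^sub>R v) -` \<Omega> = ?S" by auto
  ultimately have "closed ?S" by simp
  moreover have bdd: "bdd_below ?S" by (intro bdd_belowI[of _ 0]) simp
  moreover have ne: "?S \<noteq> {}"
  proof
    assume "?S = {}"
    then have "directional_minimal_time \<Omega> v x = \<infinity>"
      unfolding directional_minimal_time_def by (simp only: INF_empty top_ereal_def)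
    with assms(2) show False by simp
  qed
  ultimately have "Inf ?S \<in> ?S" by (intro closed_contains_Inf)
  \<comment> \<open>The value is an infimum in \<open>ereal\<close>, whereas closedness yields the
    real \<open>Inf\<close>; the two have to be identified.\<close>
  moreover have "Inf ?S = a"
  proof (rule antisym)
    have "ereal (Inf ?S) \<le> directional_minimal_time \<Omega> v x"
      unfolding directional_minimal_time_def
      using bdd by (intro INF_greatest) (simp add: cInf_lower)
    then show "Inf ?S \<le> a" by (simp add: assms(2))
    have "ereal a \<le> ereal (Inf ?S)"
      using directional_minimal_time_le[of "Inf ?S" x v \<Omega>] \<open>Inf ?S \<in> ?S\<close>
      by (simp add: assms(2))
    then show "a \<le> Inf ?S" by simp
  qed
  ultimately show ?thesis by simp
qed

text \<open>If the value were 0, attainment at time 0 would put \<open>x\<close> itself into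
  \<Omega>.\<close>

lemma directional_minimal_time_pos:
  assumes "closed \<Omega>" and "x \<notin> \<Omega>"
  shows "0 < directional_minimal_time \<Omega> v x"
  using directional_minimal_time_attained[OF assms(1), of v x 0] assms(2)
    directional_minimal_time_nonneg[of \<Omega> v x]
  by (auto simp: order_less_le zero_ereal_def)

text \<open>Translating \<open>z\<close> in \<Omega> back by \<open>a *\<^sub>R v\<close> gives a
  point of minimal time at most \<open>a\<close>, with the same displacement from \<open>x\<close>
  as \<open>z\<close> has from \<open>x + a *\<^sub>R v\<close>. The difference of values then drops
  out, leaving only the \<epsilon> term.\<close>

lemma frechet_subdifferential_minimal_time_normal:
  assumes "closed \<Omega>" and T: "directional_minimal_time \<Omega> v x = ereal a"
    and f: "f \<in> frechet_subdifferential (directional_minimal_time \<Omega> v) x"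
  shows "f \<in> frechet_normal_cone (x + a *\<^sub>R v) \<Omega>"
  unfolding frechet_normal_cone_def
proof (intro CollectI conjI allI impI)
  show "x + a *\<^sub>R v \<in> \<Omega>" by (rule directional_minimal_time_attained[OF assms(1) T])
  have "0 \<le> a" using directional_minimal_time_nonneg[of \<Omega> v x] T by simp
  fix \<epsilon> :: real assume "\<epsilon> > 0"
  then obtain \<delta> where "\<delta> > 0" and \<delta>: "\<And>y r. norm (y - x) \<le> \<delta> \<Longrightarrow>
      directional_minimal_time \<Omega> v y \<le> ereal r \<Longrightarrow>
      blinfun_apply f (y - x) \<le> r - a + \<epsilon> * norm (y - x)"
    using frechet_subdifferentialD[OF f] T by (metis real_of_ereal.simps(1))
  have "blinfun_apply f (z - (x + a *\<^sub>R v)) \<le> \<epsilon> * norm (z - (x + a *\<^sub>R v))"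
    if z: "z \<in> \<Omega>" "norm (z - (x + a *\<^sub>R v)) \<le> \<delta>" for z
  proof -
    have eq: "z - a *\<^sub>R v - x = z - (x + a *\<^sub>R v)" by simp
    have "directional_minimal_time \<Omega> v (z - a *\<^sub>R v) \<le> ereal a"
      using \<open>0 \<le> a\<close> z by (intro directional_minimal_time_le) simp_all
    from \<delta>[OF _ this] z show ?thesis unfolding eq by simp
  qed
  with \<open>\<delta> > 0\<close> show "\<exists>\<delta>>0. \<forall>z\<in>\<Omega>. norm (z - (x + a *\<^sub>R v)) \<le> \<delta> \<longrightarrow>
      blinfun_apply f (z - (x + a *\<^sub>R v)) \<le> \<epsilon> * norm (z - (x + a *\<^sub>R v))" by blast
qed

text \<open>Along the line through \<open>x\<close> in direction \<open>v\<close> the minimal time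
  is bounded above by an affine function of slope -1 that agrees with it at \<open>x\<close>.
  Testing the subgradient forwards and backwards yields both inequalities; \<open>0 < a\<close>
  leaves room for the forward step.\<close>

lemma frechet_subdifferential_minimal_time_direction:
  assumes "closed \<Omega>" and "v \<noteq> 0" and T: "directional_minimal_time \<Omega> v x = ereal a" and "0 < a"
    and f: "f \<in> frechet_subdifferential (directional_minimal_time \<Omega> v) x"
  shows "blinfun_apply f v = -1"
proof -
  have "\<bar>blinfun_apply f v + 1\<bar> \<le> 0 + e" if "e > 0" for e
  proof -
    \<comment> \<open>Dividing by \<open>norm v\<close> makes the error of a displacement
      \<open>\<sigma> *\<^sub>R v\<close> equal to \<open>e * \<bar>\<sigma>\<bar>\<close>.\<close>
    have "e / norm v > 0" using that \<open>v \<noteq> 0\<close> by simp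
    then obtain \<delta> where "\<delta> > 0" and \<delta>: "\<And>y r. norm (y - x) \<le> \<delta> \<Longrightarrow>
        directional_minimal_time \<Omega> v y \<le> ereal r \<Longrightarrow>
        blinfun_apply f (y - x) \<le> r - a + e / norm v * norm (y - x)"
      using frechet_subdifferentialD[OF f] T by (metis real_of_ereal.simps(1))
    \<comment> \<open>The bound \<open>a\<close> keeps the remaining time
      \<open>a - \<sigma>\<close> nonnegative; the other bound keeps the test point within \<delta>
      of \<open>x\<close>.\<close>
    define s where "s = min a (\<delta> / norm v)"
    have "s > 0" using \<open>0 < a\<close> \<open>\<delta> > 0\<close> \<open>v \<noteq> 0\<close> by (simp add: s_def)
    have "s * norm v \<le> \<delta>"
      using \<open>v \<noteq> 0\<close> by (simp add: s_def pos_le_divide_eq[symmetric])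
    have *: "\<sigma> * blinfun_apply f v \<le> - \<sigma> + e * s" if "\<bar>\<sigma>\<bar> = s" for \<sigma>
    proof -
      have "\<sigma> \<le> a" using that by (auto simp: s_def)
      then have "directional_minimal_time \<Omega> v (x + \<sigma> *\<^sub>R v) \<le> ereal (a - \<sigma>)"
        using directional_minimal_time_attained[OF assms(1) T]
        by (intro directional_minimal_time_le) (simp_all add: algebra_simps)
      from \<delta>[OF _ this] show ?thesis
        using that \<open>s * norm v \<le> \<delta>\<close> \<open>v \<noteq> 0\<close> by (simp add: blinfun.scaleR_right)
    qed
    have "s * (blinfun_apply f v + 1) \<le> s * e" "s * (- (blinfun_apply f v + 1)) \<le> s * e"
      using *[of s] *[of "- s"] \<open>s > 0\<close> by (simp_all add: algebra_simps)
    then show ?thesis using \<open>s > 0\<close> by (auto simp: abs_le_iff)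
  qed
  then have "\<bar>blinfun_apply f v + 1\<bar> \<le> 0" by (rule field_le_epsilon)
  then show ?thesis by simp
qed

theorem theorem3p21:
  fixes \<Omega> :: "'a::real_normed_vector set" and v xbar :: 'a
  assumes "\<Omega> \<noteq> {}" and "closed \<Omega>" and "v \<noteq> 0"
    and "xbar \<in> effective_domain (directional_minimal_time \<Omega> v) - \<Omega>"
  shows "singular_subdifferential (directional_minimal_time \<Omega> v) xbar
    \<subseteq> annihilator {v} \<inter>
      limiting_normal_cone (xbar + real_of_ereal (directional_minimal_time \<Omega> v xbar) *\<^sub>R v) \<Omega>"
proof
  let ?T = "directional_minimal_time \<Omega> v"
  let ?t = "\<lambda>x. real_of_ereal (?T x)"
  fix f assume "f \<in> singular_subdifferential ?T xbar"
  then obtain ls xs fs where fin: "\<bar>?T xbar\<bar> \<noteq> \<infinity>"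
    and ls: "ls \<longlonglongrightarrow> 0" "\<And>k. ls k > 0" and xs: "xs \<longlonglongrightarrow> xbar"
    and Txs: "(\<lambda>k. ?T (xs k)) \<longlonglongrightarrow> ?T xbar"
    and fs: "\<And>k. fs k \<in> frechet_subdifferential ?T (xs k)"
    and lim: "limitin weak_star_topology (\<lambda>k. ls k *\<^sub>R fs k) f sequentially"
    unfolding singular_subdifferential_def by auto
  \<comment> \<open>A point that has a Frechet subgradient has a finite value by definition.\<close>
  have T: "?T (xs k) = ereal (?t (xs k))" for k
    using fs[of k] by (auto simp: frechet_subdifferential_def ereal_real')
  have "(\<lambda>k. ?t (xs k)) \<longlonglongrightarrow> ?t xbar"
    using Txs fin by (intro tendsto_intros) (auto simp: ereal_real')
  then have "(\<lambda>k. xs k + ?t (xs k) *\<^sub>R v) \<longlonglongrightarrow> xbar + ?t xbar *\<^sub>R v"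
    using xs by (intro tendsto_add tendsto_scaleR tendsto_const)
  moreover have "ls k *\<^sub>R fs k \<in> frechet_normal_cone (xs k + ?t (xs k) *\<^sub>R v) \<Omega>" for k
    using frechet_subdifferential_minimal_time_normal[OF assms(2) T fs] ls(2)
    by (rule frechet_normal_cone_scaleR)
  moreover have "xs k + ?t (xs k) *\<^sub>R v \<in> \<Omega>" for k
    by (rule directional_minimal_time_attained[OF assms(2) T])
  \<comment> \<open>The witnesses are the points where the rays from \<open>xs k\<close> first meet
    \<Omega>, with the already scaled subgradients as normals.\<close>
  ultimately have normal: "f \<in> limiting_normal_cone (xbar + ?t xbar *\<^sub>R v) \<Omega>"
    unfolding limiting_normal_cone_def using lim
    by (intro CollectI exI[of _ "\<lambda>k. xs k + ?t (xs k) *\<^sub>R v"]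
        exI[of _ "\<lambda>k. ls k *\<^sub>R fs k"]) blast

  \<comment> \<open>Convergence of the values carries positivity at \<open>xbar\<close> over to a
    tail of the sequence, where the value of the subgradients at \<open>v\<close> is known.\<close>
  have "0 < ?T xbar" using assms by (intro directional_minimal_time_pos) auto
  with Txs have "\<forall>\<^sub>F k in sequentially. 0 < ?T (xs k)" by (rule order_tendstoD)
  then have "\<forall>\<^sub>F k in sequentially. - ls k = blinfun_apply (ls k *\<^sub>R fs k) v"
  proof eventually_elim
    case (elim k)
    then have "0 < ?t (xs k)" using T[of k] by (metis ereal_less(2))
    then have "blinfun_apply (fs k) v = -1"
      by (rule frechet_subdifferential_minimal_time_direction[OF assms(2,3) T _ fs])
    then show ?case by (simp add: blinfun.scaleR_left)
  qed
  moreover have "(\<lambda>k. - ls k) \<longlonglongrightarrow> 0" using tendsto_minus[OF ls(1)] by simp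
  ultimately have "(\<lambda>k. blinfun_apply (ls k *\<^sub>R fs k) v) \<longlonglongrightarrow> 0"
    by (rule Lim_transform_eventually[rotated])
  \<comment> \<open>Weak* convergence is used here only through evaluation at
    \<open>v\<close>.\<close>
  moreover have "(\<lambda>k. blinfun_apply (ls k *\<^sub>R fs k) v) \<longlonglongrightarrow> blinfun_apply f v"
    using lim by (simp add: limitin_weak_star_iff)
  ultimately have "blinfun_apply f v = 0" by (rule LIMSEQ_unique[rotated])
  with normal show "f \<in> annihilator {v} \<inter> limiting_normal_cone (xbar + ?t xbar *\<^sub>R v) \<Omega>"
    by (simp add: annihilator_def)
qed

end
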